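(* Let $G\rightrightarrows M$ be a Lie groupoid with source $\alpha$ and target $\beta$, and let $E\subseteq G$ be a submanifold (an implicit difference equation on $G$). Let $(C_f^k,E_f^k)$, $(D_b^k,E_b^k)$, $(C_{fb}^k,D_{fb}^k,E_{fb}^k)$, $k\ge 0$, be the sequences of subsets produced from $E$ by the forward, backward and two-sided integrability algorithms defined in the context. (1) If there is $k_f\ge 0$ with $C_f^{k_f}=C_f^{k_f+1}$, and $\bar E_f:=E_f^{k_f+1}=E_f^{k_f+2}$ denotes the corresponding final set, then the forward integrable part of $E$ is $\bar E_f$, i.e. $\tilde E_f=\bar E_f$. (2) If there is $k_b\ge 0$ with $D_b^{k_b}=D_b^{k_b+1}$, and $\bar E_b:=E_b^{k_b+1}=E_b^{k_b+2}$, then the backward integrable part of $E$ is $\bar E_b$, i.e. $\tilde E_b=\bar E_b$. (3) If there is $k_{fb}\ge 0$ with $C_{fb}^{k_{fb}}=C_{fb}^{k_{fb}+1}$ and $D_{fb}^{k_{fb}}=D_{fb}^{k_{fb}+1}$, and $\bar E_{fb}:=E_{fb}^{k_{fb}+1}=E_{fb}^{k_{fb}+2}$, then the integrable part of $E$ is $\bar E_{fb}$, i.e. $\tilde E_{fb}=\bar E_{fb}$.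
   Context: For a Lie groupoid $G\rightrightarrows M$ with source $\alpha:G\to M$ and target $\beta:G\to M$ (surjective submersions), the set of composable pairs is $G_2=\{(g,h)\in G\times G: \beta(g)=\alpha(h)\}$. For an interval $I\subseteq\mathbb{R}$, an admissible sequence is a map $\gamma:I\cap\mathbb{Z}\to G$ with $\beta(\gamma(i))=\alpha(\gamma(i+1))$ whenever $i,i+1\in I\cap\mathbb{Z}$. An implicit difference equation on $G$ is a submanifold $E\subseteq G$; a solution of $E$ is an admissible sequence with $\gamma(i)\in E$ for all $i\in I\cap\mathbb{Z}$. Let $\mathbb{Z}^+=\{n\in\mathbb{Z}:n\ge 0\}$ and $\mathbb{Z}^-=\{n\in\mathbb{Z}:n\le 0\}$. $E$ is forward integrable (resp. backward integrable, integrable) at $g\in E$ if there is a solution $\gamma:\mathbb{Z}^+\to E$ (resp. $\gamma:\mathbb{Z}^-\to E$, $\gamma:\mathbb{Z}\to E$) with $\gamma(0)=g$. The forward integrable part $\tilde E_f$, backward integrable part $\tilde E_b$ and integrable part $\tilde E_{fb}$ are the sets of those $g\in E$ at which $E$ is forward integrable, backward integrable, integrable, respectively. Algorithms (sequences of subsets of $M$ and of $G$): Forward: $C_f^0=\alpha(E)$, $E_f^0=E$, and for $k\ge1$: $C_f^k=\alpha(E\cap\beta^{-1}(C_f^{k-1}))$, $E_f^k=E\cap\beta^{-1}(C_f^{k-1})$. Backward: $D_b^0=\beta(E)$, $E_b^0=E$, and for $k\ge1$: $D_b^k=\beta(E\cap\alpha^{-1}(D_b^{k-1}))$, $E_b^k=E\cap\alpha^{-1}(D_b^{k-1})$.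 Two-sided: $C_{fb}^0=\alpha(E)$, $D_{fb}^0=\beta(E)$, $E_{fb}^0=E$, and for $k\ge1$: $E_{fb}^k=E\cap\alpha^{-1}(D_{fb}^{k-1})\cap\beta^{-1}(C_{fb}^{k-1})$, $C_{fb}^k=\alpha(E_{fb}^k)$, $D_{fb}^k=\beta(E_{fb}^k)$. If the sets of $M$ in two consecutive steps coincide as in (1), (2), (3), then directly from the definitions the corresponding subsets of $G$ coincide from the next step on, so $\bar E_f,\bar E_b,\bar E_{fb}$ are well defined. *)

theory Defs
  imports "HOL-Analysis.Analysis"
begin

section \<open>Smooth functions on open subsets of \<open>\<real>\<^sup>n\<close>\<close>

text \<open>
  Coordinate space \<open>\<real>\<^sup>n\<close> is the library's \<^const>\<open>Euclidean_space\<close> \<open>n\<close>, the functions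
  \<open>x :: nat \<Rightarrow> real\<close> with \<open>x i = 0\<close> for \<open>i \<ge> n\<close>.  In contrast to the class \<^class>\<open>euclidean_space\<close>
  this includes \<open>n = 0\<close>, so that Lie groups (Lie groupoids over a point) are covered below.
\<close>

definition partial_deriv :: "nat \<Rightarrow> ((nat \<Rightarrow> real) \<Rightarrow> real) \<Rightarrow> (nat \<Rightarrow> real) \<Rightarrow> real" where
  "partial_deriv i f x = deriv (\<lambda>t. f (x(i := t))) (x i)"

primrec Ck_on :: "nat \<Rightarrow> nat \<Rightarrow> (nat \<Rightarrow> real) set \<Rightarrow> ((nat \<Rightarrow> real) \<Rightarrow> real) \<Rightarrow> bool" where
  "Ck_on n 0 U f \<longleftrightarrow> continuous_map (subtopology (Euclidean_space n) U) euclideanreal f"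
| "Ck_on n (Suc k) U f \<longleftrightarrow>
     continuous_map (subtopology (Euclidean_space n) U) euclideanreal f \<and>
     (\<forall>i<n. (\<forall>x\<in>U. (\<lambda>t. f (x(i := t))) differentiable at (x i)) \<and>
            Ck_on n k U (partial_deriv i f))"

definition smooth_on :: "nat \<Rightarrow> nat \<Rightarrow> (nat \<Rightarrow> real) set \<Rightarrow> ((nat \<Rightarrow> real) \<Rightarrow> (nat \<Rightarrow> real)) \<Rightarrow> bool" where
  "smooth_on n m U f \<longleftrightarrow> (\<forall>j<m. \<forall>k. Ck_on n k U (\<lambda>x. f x j))"

text \<open>The total derivative at \<open>x\<close> of \<open>f : \<real>\<^sup>n \<rightarrow> \<real>\<^sup>m\<close> (the Jacobian matrix) applied to \<open>v\<close>.\<close>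

definition jacobian ::
    "nat \<Rightarrow> nat \<Rightarrow> ((nat \<Rightarrow> real) \<Rightarrow> (nat \<Rightarrow> real)) \<Rightarrow> (nat \<Rightarrow> real) \<Rightarrow> (nat \<Rightarrow> real) \<Rightarrow> (nat \<Rightarrow> real)" where
  "jacobian n m f x v =
     (\<lambda>j. if j < m then \<Sum>i<n. partial_deriv i (\<lambda>y. f y j) x * v i else 0)"


section \<open>Smooth manifolds\<close>

type_synonym 'a chart = "'a set \<times> ('a \<Rightarrow> nat \<Rightarrow> real)"

record 'a manifold =
  mfd_dim :: nat
  mfd_top :: "'a topology"
  mfd_atlas :: "'a chart set"

abbreviation points :: "'a manifold \<Rightarrow> 'a set" where
  "points X \<equiv> topspace (mfd_top X)"

definition is_chart :: "nat \<Rightarrow> 'a topology \<Rightarrow> 'a chart \<Rightarrow> bool" where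
  "is_chart n T c \<longleftrightarrow> (case c of (U, \<phi>) \<Rightarrow>
     openin T U \<and> openin (Euclidean_space n) (\<phi> ` U) \<and>
     homeomorphic_map (subtopology T U) (subtopology (Euclidean_space n) (\<phi> ` U)) \<phi>)"

definition smoothly_compatible :: "nat \<Rightarrow> 'a chart \<Rightarrow> 'a chart \<Rightarrow> bool" where
  "smoothly_compatible n c d \<longleftrightarrow> (case (c, d) of ((U, \<phi>), (V, \<psi>)) \<Rightarrow>
     smooth_on n n (\<phi> ` (U \<inter> V)) (\<psi> \<circ> inv_into U \<phi>))"

text \<open>
  A finite-dimensional, Hausdorff, second countable smooth manifold.  The atlas need not be
  maximal.
\<close>

definition smooth_manifold :: "'a manifold \<Rightarrow> bool" where
  "smooth_manifold X \<longleftrightarrow>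
     Hausdorff_space (mfd_top X) \<and> second_countable (mfd_top X) \<and>
     (\<forall>c \<in> mfd_atlas X. is_chart (mfd_dim X) (mfd_top X) c) \<and>
     (\<Union>c \<in> mfd_atlas X. fst c) = points X \<and>
     (\<forall>c \<in> mfd_atlas X. \<forall>d \<in> mfd_atlas X. smoothly_compatible (mfd_dim X) c d)"

definition prod_manifold :: "'a manifold \<Rightarrow> 'b manifold \<Rightarrow> ('a \<times> 'b) manifold" where
  "prod_manifold X Y =
     \<lparr> mfd_dim = mfd_dim X + mfd_dim Y,
       mfd_top = prod_topology (mfd_top X) (mfd_top Y),
       mfd_atlas = {(U \<times> V, \<lambda>(p, q) i. if i < mfd_dim X then \<phi> p i else \<psi> q (i - mfd_dim X)) | U \<phi> V \<psi>.
                      (U, \<phi>) \<in> mfd_atlas X \<and> (V, \<psi>) \<in> mfd_atlas Y} \<rparr>"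


section \<open>Smooth maps, immersions, submersions, submanifolds\<close>

definition local_dom :: "'a chart \<Rightarrow> 'b chart \<Rightarrow> ('a \<Rightarrow> 'b) \<Rightarrow> (nat \<Rightarrow> real) set" where
  "local_dom c d f = snd c ` {p \<in> fst c. f p \<in> fst d}"

definition local_rep :: "'a chart \<Rightarrow> 'b chart \<Rightarrow> ('a \<Rightarrow> 'b) \<Rightarrow> (nat \<Rightarrow> real) \<Rightarrow> (nat \<Rightarrow> real)" where
  "local_rep c d f = snd d \<circ> f \<circ> inv_into (fst c) (snd c)"

text \<open>Continuity of \<open>f\<close> makes the domains \<^const>\<open>local_dom\<close> of the local representatives open.\<close>

definition smooth_map :: "'a manifold \<Rightarrow> 'b manifold \<Rightarrow> ('a \<Rightarrow> 'b) \<Rightarrow> bool" where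
  "smooth_map X Y f \<longleftrightarrow>
     continuous_map (mfd_top X) (mfd_top Y) f \<and>
     (\<forall>c \<in> mfd_atlas X. \<forall>d \<in> mfd_atlas Y.
        smooth_on (mfd_dim X) (mfd_dim Y) (local_dom c d f) (local_rep c d f))"

definition immersion :: "'a manifold \<Rightarrow> 'b manifold \<Rightarrow> ('a \<Rightarrow> 'b) \<Rightarrow> bool" where
  "immersion X Y f \<longleftrightarrow>
     smooth_map X Y f \<and>
     (\<forall>c \<in> mfd_atlas X. \<forall>d \<in> mfd_atlas Y. \<forall>x \<in> local_dom c d f.
        inj_on (jacobian (mfd_dim X) (mfd_dim Y) (local_rep c d f) x)
          (topspace (Euclidean_space (mfd_dim X))))"

definition submersion :: "'a manifold \<Rightarrow> 'b manifold \<Rightarrow> ('a \<Rightarrow> 'b) \<Rightarrow> bool" where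
  "submersion X Y f \<longleftrightarrow>
     smooth_map X Y f \<and>
     (\<forall>c \<in> mfd_atlas X. \<forall>d \<in> mfd_atlas Y. \<forall>x \<in> local_dom c d f.
        jacobian (mfd_dim X) (mfd_dim Y) (local_rep c d f) x
          ` topspace (Euclidean_space (mfd_dim X)) = topspace (Euclidean_space (mfd_dim Y)))"

definition surjective_submersion :: "'a manifold \<Rightarrow> 'b manifold \<Rightarrow> ('a \<Rightarrow> 'b) \<Rightarrow> bool" where
  "surjective_submersion X Y f \<longleftrightarrow> submersion X Y f \<and> f ` points X = points Y"

text \<open>
  \<open>S\<close> is an immersed submanifold of \<open>X\<close>, i.e. the inclusion \<open>S \<rightarrow> X\<close> is an injective immersion.
  It is embedded if in addition it carries the subspace topology.
\<close>

definition immersed_in :: "'a manifold \<Rightarrow> 'a manifold \<Rightarrow> bool" where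
  "immersed_in S X \<longleftrightarrow> smooth_manifold S \<and> points S \<subseteq> points X \<and> immersion S X (\<lambda>p. p)"

definition embedded_in :: "'a manifold \<Rightarrow> 'a manifold \<Rightarrow> bool" where
  "embedded_in S X \<longleftrightarrow> immersed_in S X \<and> mfd_top S = subtopology (mfd_top X) (points S)"

text \<open>Submanifolds are allowed to be merely immersed; embedded ones are a special case.\<close>

definition submanifold :: "'a manifold \<Rightarrow> 'a set \<Rightarrow> bool" where
  "submanifold X E \<longleftrightarrow> (\<exists>S. immersed_in S X \<and> points S = E)"


section \<open>Lie groupoids\<close>

definition composable_pairs :: "'g set \<Rightarrow> ('g \<Rightarrow> 'm) \<Rightarrow> ('g \<Rightarrow> 'm) \<Rightarrow> ('g \<times> 'g) set" where
  "composable_pairs A \<alpha> \<beta> = {(g, h). g \<in> A \<and> h \<in> A \<and> \<beta> g = \<alpha> h}"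

text \<open>
  \<open>\<alpha>\<close>, \<open>\<beta>\<close>, \<open>\<epsilon>\<close>, \<open>\<iota>\<close>, \<open>\<mu>\<close> are source, target, identity section, inversion and multiplication;
  \<open>\<mu> g h\<close> is meaningful only for composable \<open>(g, h)\<close>.  Smoothness of \<open>\<mu>\<close> refers to the (unique)
  structure of an embedded submanifold of \<open>G \<times> G\<close> on the set of composable pairs, which exists
  because \<open>\<alpha>\<close> and \<open>\<beta>\<close> are submersions.
\<close>

locale lie_groupoid =
  fixes G :: "'g manifold" and M :: "'m manifold"
    and \<alpha> \<beta> :: "'g \<Rightarrow> 'm" and \<epsilon> :: "'m \<Rightarrow> 'g" and \<iota> :: "'g \<Rightarrow> 'g" and \<mu> :: "'g \<Rightarrow> 'g \<Rightarrow> 'g"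
  assumes manifold_G: "smooth_manifold G"
    and manifold_M: "smooth_manifold M"
    and source_submersion: "surjective_submersion G M \<alpha>"
    and target_submersion: "surjective_submersion G M \<beta>"
    and unit_smooth: "smooth_map M G \<epsilon>"
    and inverse_smooth: "smooth_map G G \<iota>"
    and mult_smooth: "\<exists>P. embedded_in P (prod_manifold G G) \<and>
          points P = composable_pairs (points G) \<alpha> \<beta> \<and> smooth_map P G (\<lambda>(g, h). \<mu> g h)"
    and source_mult: "(g, h) \<in> composable_pairs (points G) \<alpha> \<beta> \<Longrightarrow> \<alpha> (\<mu> g h) = \<alpha> g"
    and target_mult: "(g, h) \<in> composable_pairs (points G) \<alpha> \<beta> \<Longrightarrow> \<beta> (\<mu> g h) = \<beta> h"
    and mult_assoc: "(g, h) \<in> composable_pairs (points G) \<alpha> \<beta> \<Longrightarrow>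
          (h, k) \<in> composable_pairs (points G) \<alpha> \<beta> \<Longrightarrow> \<mu> (\<mu> g h) k = \<mu> g (\<mu> h k)"
    and source_unit: "x \<in> points M \<Longrightarrow> \<alpha> (\<epsilon> x) = x"
    and target_unit: "x \<in> points M \<Longrightarrow> \<beta> (\<epsilon> x) = x"
    and unit_left: "g \<in> points G \<Longrightarrow> \<mu> (\<epsilon> (\<alpha> g)) g = g"
    and unit_right: "g \<in> points G \<Longrightarrow> \<mu> g (\<epsilon> (\<beta> g)) = g"
    and source_inverse: "g \<in> points G \<Longrightarrow> \<alpha> (\<iota> g) = \<beta> g"
    and target_inverse: "g \<in> points G \<Longrightarrow> \<beta> (\<iota> g) = \<alpha> g"
    and inverse_right: "g \<in> points G \<Longrightarrow> \<mu> g (\<iota> g) = \<epsilon> (\<alpha> g)"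
    and inverse_left: "g \<in> points G \<Longrightarrow> \<mu> (\<iota> g) g = \<epsilon> (\<beta> g)"


section \<open>Implicit difference equations and their integrable parts\<close>

text \<open>
  Sequences \<open>I \<inter> \<int> \<rightarrow> G\<close> are functions on all of \<^typ>\<open>int\<close> of which only the values at the
  integers in the real interval \<open>I\<close> matter.
\<close>

definition admissible_sequence ::
    "'g manifold \<Rightarrow> ('g \<Rightarrow> 'm) \<Rightarrow> ('g \<Rightarrow> 'm) \<Rightarrow> real set \<Rightarrow> (int \<Rightarrow> 'g) \<Rightarrow> bool" where
  "admissible_sequence G \<alpha> \<beta> I \<gamma> \<longleftrightarrow>
     is_interval I \<and>
     (\<forall>i. of_int i \<in> I \<longrightarrow> \<gamma> i \<in> points G) \<and>
     (\<forall>i. of_int i \<in> I \<and> of_int (i + 1) \<in> I \<longrightarrow> \<beta> (\<gamma> i) = \<alpha> (\<gamma> (i + 1)))"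

definition solution ::
    "'g manifold \<Rightarrow> ('g \<Rightarrow> 'm) \<Rightarrow> ('g \<Rightarrow> 'm) \<Rightarrow> 'g set \<Rightarrow> real set \<Rightarrow> (int \<Rightarrow> 'g) \<Rightarrow> bool" where
  "solution G \<alpha> \<beta> E I \<gamma> \<longleftrightarrow>
     admissible_sequence G \<alpha> \<beta> I \<gamma> \<and> (\<forall>i. of_int i \<in> I \<longrightarrow> \<gamma> i \<in> E)"

definition forward_integrable_part ::
    "'g manifold \<Rightarrow> ('g \<Rightarrow> 'm) \<Rightarrow> ('g \<Rightarrow> 'm) \<Rightarrow> 'g set \<Rightarrow> 'g set" where
  "forward_integrable_part G \<alpha> \<beta> E = {g \<in> E. \<exists>\<gamma>. solution G \<alpha> \<beta> E {0..} \<gamma> \<and> \<gamma> 0 = g}"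

definition backward_integrable_part ::
    "'g manifold \<Rightarrow> ('g \<Rightarrow> 'm) \<Rightarrow> ('g \<Rightarrow> 'm) \<Rightarrow> 'g set \<Rightarrow> 'g set" where
  "backward_integrable_part G \<alpha> \<beta> E = {g \<in> E. \<exists>\<gamma>. solution G \<alpha> \<beta> E {..0} \<gamma> \<and> \<gamma> 0 = g}"

definition integrable_part ::
    "'g manifold \<Rightarrow> ('g \<Rightarrow> 'm) \<Rightarrow> ('g \<Rightarrow> 'm) \<Rightarrow> 'g set \<Rightarrow> 'g set" where
  "integrable_part G \<alpha> \<beta> E = {g \<in> E. \<exists>\<gamma>. solution G \<alpha> \<beta> E UNIV \<gamma> \<and> \<gamma> 0 = g}"


section \<open>The integrability algorithms\<close>

primrec C_f :: "('g \<Rightarrow> 'm) \<Rightarrow> ('g \<Rightarrow> 'm) \<Rightarrow> 'g set \<Rightarrow> nat \<Rightarrow> 'm set" where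
  "C_f \<alpha> \<beta> E 0 = \<alpha> ` E"
| "C_f \<alpha> \<beta> E (Suc k) = \<alpha> ` (E \<inter> \<beta> -` C_f \<alpha> \<beta> E k)"

primrec E_f :: "('g \<Rightarrow> 'm) \<Rightarrow> ('g \<Rightarrow> 'm) \<Rightarrow> 'g set \<Rightarrow> nat \<Rightarrow> 'g set" where
  "E_f \<alpha> \<beta> E 0 = E"
| "E_f \<alpha> \<beta> E (Suc k) = E \<inter> \<beta> -` C_f \<alpha> \<beta> E k"

primrec D_b :: "('g \<Rightarrow> 'm) \<Rightarrow> ('g \<Rightarrow> 'm) \<Rightarrow> 'g set \<Rightarrow> nat \<Rightarrow> 'm set" where
  "D_b \<alpha> \<beta> E 0 = \<beta> ` E"
| "D_b \<alpha> \<beta> E (Suc k) = \<beta> ` (E \<inter> \<alpha> -` D_b \<alpha> \<beta> E k)"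

primrec E_b :: "('g \<Rightarrow> 'm) \<Rightarrow> ('g \<Rightarrow> 'm) \<Rightarrow> 'g set \<Rightarrow> nat \<Rightarrow> 'g set" where
  "E_b \<alpha> \<beta> E 0 = E"
| "E_b \<alpha> \<beta> E (Suc k) = E \<inter> \<alpha> -` D_b \<alpha> \<beta> E k"

primrec E_fb :: "('g \<Rightarrow> 'm) \<Rightarrow> ('g \<Rightarrow> 'm) \<Rightarrow> 'g set \<Rightarrow> nat \<Rightarrow> 'g set" where
  "E_fb \<alpha> \<beta> E 0 = E"
| "E_fb \<alpha> \<beta> E (Suc k) = E \<inter> \<alpha> -` (\<beta> ` E_fb \<alpha> \<beta> E k) \<inter> \<beta> -` (\<alpha> ` E_fb \<alpha> \<beta> E k)"

definition C_fb :: "('g \<Rightarrow> 'm) \<Rightarrow> ('g \<Rightarrow> 'm) \<Rightarrow> 'g set \<Rightarrow> nat \<Rightarrow> 'm set" where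
  "C_fb \<alpha> \<beta> E k = \<alpha> ` E_fb \<alpha> \<beta> E k"

definition D_fb :: "('g \<Rightarrow> 'm) \<Rightarrow> ('g \<Rightarrow> 'm) \<Rightarrow> 'g set \<Rightarrow> nat \<Rightarrow> 'm set" where
  "D_fb \<alpha> \<beta> E k = \<beta> ` E_fb \<alpha> \<beta> E k"

lemma E_fb_Suc_eq: "E_fb \<alpha> \<beta> E (Suc k) = E \<inter> \<alpha> -` D_fb \<alpha> \<beta> E k \<inter> \<beta> -` C_fb \<alpha> \<beta> E k"
  by (simp add: C_fb_def D_fb_def)

end

theory Submission
  imports Defs
begin

text \<open>
  Call \<open>S \<subseteq> E\<close> forward invariant if \<open>\<beta> ` S \<subseteq> \<alpha> ` S\<close>: every point of \<open>S\<close> has a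
  composable successor in \<open>S\<close>.  The forward integrable part is the largest forward invariant subset of
  \<open>E\<close>.  It is invariant because a solution shifted by one is a solution, and it contains every
  invariant set because steps inside such a set can be iterated forever.  The map sending \<open>S\<close> to
  \<open>E \<inter> \<beta> -` (\<alpha> ` S)\<close> is monotone and its post-fixed points within \<open>E\<close> are the forward invariant
  sets; the algorithm iterates it from \<open>E\<close>.  Hence every iterate contains every invariant set, in
  particular the forward integrable part, while an iterate at which the algorithm stops is invariant
  itself and is therefore contained in the forward integrable part.

  Reversing time exchanges \<open>\<alpha>\<close> with \<open>\<beta>\<close> and forward with backward, which gives the backward case.
  The two-sided case runs in the same way with sets that are invariant in both directions: a forward
  and a backward solution that start at the same point glue to a solution on all of \<open>\<int>\<close>.
\<close>

section \<open>Translating, reversing and gluing solutions\<close>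

lemma solution_translate:
  assumes "solution G \<alpha> \<beta> E I \<gamma>" and "is_interval J"
    and "\<And>i. of_int i \<in> J \<Longrightarrow> of_int (i + c) \<in> I"
  shows "solution G \<alpha> \<beta> E J (\<lambda>i. \<gamma> (i + c))"
proof -
  have "\<beta> (\<gamma> (i + c)) = \<alpha> (\<gamma> (i + 1 + c))" if "of_int i \<in> J" "of_int (i + 1) \<in> J" for i
  proof -
    have "of_int (i + c) \<in> I" "of_int (i + c + 1) \<in> I"
      using assms(3)[OF that(1)] assms(3)[OF that(2)] by (simp_all add: add_ac)
    then have "\<beta> (\<gamma> (i + c)) = \<alpha> (\<gamma> (i + c + 1))"
      using assms(1) unfolding solution_def admissible_sequence_def by blast
    then show ?thesis by (simp add: add_ac)
  qed
  then show ?thesis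
    using assms unfolding solution_def admissible_sequence_def by blast
qed

lemma solution_reverse:
  assumes "solution G \<alpha> \<beta> E I \<gamma>" and "is_interval J"
    and "\<And>i. of_int i \<in> J \<Longrightarrow> of_int (- i) \<in> I"
  shows "solution G \<beta> \<alpha> E J (\<lambda>i. \<gamma> (- i))"
proof -
  have "\<alpha> (\<gamma> (- i)) = \<beta> (\<gamma> (- (i + 1)))" if "of_int i \<in> J" "of_int (i + 1) \<in> J" for i
  proof -
    have "of_int (- (i + 1)) \<in> I" "of_int (- (i + 1) + 1) \<in> I"
      using assms(3)[OF that(1)] assms(3)[OF that(2)] by simp_all
    then have "\<beta> (\<gamma> (- (i + 1))) = \<alpha> (\<gamma> (- (i + 1) + 1))"
      using assms(1) unfolding solution_def admissible_sequence_def by blast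
    then show ?thesis by simp
  qed
  then show ?thesis
    using assms unfolding solution_def admissible_sequence_def by blast
qed

lemma solution_glue:
  assumes fwd: "solution G \<alpha> \<beta> E {0..} \<gamma>" and bwd: "solution G \<alpha> \<beta> E {..0} \<delta>"
    and eq: "\<gamma> 0 = \<delta> 0"
  shows "solution G \<alpha> \<beta> E UNIV (\<lambda>i. if 0 \<le> i then \<gamma> i else \<delta> i)"
proof -
  have f: "\<gamma> i \<in> points G" "\<gamma> i \<in> E" "\<beta> (\<gamma> i) = \<alpha> (\<gamma> (i + 1))" if "0 \<le> i" for i
    using fwd that unfolding solution_def admissible_sequence_def by auto
  have b: "\<delta> i \<in> points G" "\<delta> i \<in> E" if "i \<le> 0" for i
    using bwd that unfolding solution_def admissible_sequence_def by auto
  have "\<beta> (\<delta> i) = \<alpha> (\<delta> (i + 1))" if "i < 0" for i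
  proof -
    have "real_of_int i \<in> {..0}" "real_of_int (i + 1) \<in> {..0}"
      using that by (auto simp del: of_int_add)
    then show ?thesis
      using bwd unfolding solution_def admissible_sequence_def by blast
  qed
  \<comment> \<open>The step from \<open>-1\<close> to \<open>0\<close> is one of \<open>\<delta>\<close>; there the two values at \<open>0\<close> have to agree.\<close>
  moreover have "i + 1 = 0" if "i < 0" "0 \<le> i + 1" for i :: int
    using that by linarith
  ultimately have "\<beta> (if 0 \<le> i then \<gamma> i else \<delta> i)
      = \<alpha> (if 0 \<le> i + 1 then \<gamma> (i + 1) else \<delta> (i + 1))" for i
    using f(3) eq by (smt (verit))
  then show ?thesis
    using f b unfolding solution_def admissible_sequence_def by simp
qed

section \<open>The forward integrable part as the largest forward invariant subset\<close>

lemma forward_integrable_part_invariant: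
  "\<beta> ` forward_integrable_part G \<alpha> \<beta> E \<subseteq> \<alpha> ` forward_integrable_part G \<alpha> \<beta> E"
proof (rule image_subsetI)
  fix g assume "g \<in> forward_integrable_part G \<alpha> \<beta> E"
  then obtain \<gamma> where sol: "solution G \<alpha> \<beta> E {0..} \<gamma>" and "\<gamma> 0 = g"
    unfolding forward_integrable_part_def by blast
  have "solution G \<alpha> \<beta> E {0..} (\<lambda>i. \<gamma> (i + 1))"
    by (rule solution_translate[OF sol]) (auto simp: is_interval_ci)
  moreover have "\<gamma> 1 \<in> E" and step: "\<beta> g = \<alpha> (\<gamma> 1)"
    using sol \<open>\<gamma> 0 = g\<close> unfolding solution_def admissible_sequence_def by force+
  ultimately have "\<gamma> 1 \<in> forward_integrable_part G \<alpha> \<beta> E"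
    unfolding forward_integrable_part_def by force
  then show "\<beta> g \<in> \<alpha> ` forward_integrable_part G \<alpha> \<beta> E"
    using step by blast
qed

text \<open>
  Invariance provides, by choice, a successor map of \<open>S\<close> into itself; its iterates from \<open>g\<close> are a
  solution.
\<close>

lemma forward_invariant_subset_forward_integrable_part:
  assumes "S \<subseteq> E" and "E \<subseteq> points G" and inv: "\<beta> ` S \<subseteq> \<alpha> ` S"
  shows "S \<subseteq> forward_integrable_part G \<alpha> \<beta> E"
proof
  fix g assume "g \<in> S"
  have "\<forall>h\<in>S. \<exists>h'. h' \<in> S \<and> \<beta> h = \<alpha> h'"
    using inv by blast
  then obtain succ where succ_S: "\<And>h. h \<in> S \<Longrightarrow> succ h \<in> S" "\<And>h. h \<in> S \<Longrightarrow> \<beta> h = \<alpha> (succ h)"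
    by metis
  define \<gamma> where "\<gamma> i = (succ ^^ nat i) g" for i :: int
  have mem: "\<gamma> i \<in> S" for i
  proof -
    have "(succ ^^ n) g \<in> S" for n
      by (induction n) (use \<open>g \<in> S\<close> succ_S(1) in auto)
    then show ?thesis by (simp add: \<gamma>_def)
  qed
  have "\<gamma> (i + 1) = succ (\<gamma> i)" if "0 \<le> i" for i
    using that by (simp add: \<gamma>_def nat_add_distrib)
  then have "solution G \<alpha> \<beta> E {0..} \<gamma>"
    using mem succ_S(2) subsetD[OF assms(1)] subsetD[OF assms(2)]
    unfolding solution_def admissible_sequence_def by (simp add: is_interval_ci)
  moreover have "\<gamma> 0 = g" by (simp add: \<gamma>_def)
  ultimately show "g \<in> forward_integrable_part G \<alpha> \<beta> E"
    unfolding forward_integrable_part_def using \<open>g \<in> S\<close> \<open>S \<subseteq> E\<close> by blast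
qed

lemma C_f_eq_source_image: "C_f \<alpha> \<beta> E k = \<alpha> ` E_f \<alpha> \<beta> E k"
  by (cases k) auto

text \<open>
  Induction along the algorithm: if \<open>S\<close> lies in the current iterate, then sources of that iterate
  cover \<open>\<alpha> ` S\<close> and hence the targets of \<open>S\<close>, so that no point of \<open>S\<close> is discarded in the next step.
\<close>

lemma forward_invariant_subset_E_f:
  assumes "S \<subseteq> E" and "\<beta> ` S \<subseteq> \<alpha> ` S"
  shows "S \<subseteq> E_f \<alpha> \<beta> E k"
proof (induction k)
  case (Suc k)
  then have "\<beta> ` S \<subseteq> \<alpha> ` E_f \<alpha> \<beta> E k"
    using assms(2) by blast
  then show ?case
    using assms(1) by (auto simp: C_f_eq_source_image)
qed (simp add: assms(1))

lemma forward_integrable_part_eq_stable_E_f: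
  assumes "E \<subseteq> points G" and stable: "C_f \<alpha> \<beta> E k = C_f \<alpha> \<beta> E (Suc k)"
  shows "forward_integrable_part G \<alpha> \<beta> E = E_f \<alpha> \<beta> E (Suc k)"
proof
  show "forward_integrable_part G \<alpha> \<beta> E \<subseteq> E_f \<alpha> \<beta> E (Suc k)"
    by (rule forward_invariant_subset_E_f[OF _ forward_integrable_part_invariant])
      (auto simp: forward_integrable_part_def)
next
  \<comment> \<open>Stability makes the final iterate invariant: the set confining its targets is its source set.\<close>
  have "\<beta> ` E_f \<alpha> \<beta> E (Suc k) \<subseteq> C_f \<alpha> \<beta> E k"
    by auto
  also have "\<dots> = \<alpha> ` E_f \<alpha> \<beta> E (Suc k)"
    unfolding stable by (rule C_f_eq_source_image)
  finally show "E_f \<alpha> \<beta> E (Suc k) \<subseteq> forward_integrable_part G \<alpha> \<beta> E"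
    by (intro forward_invariant_subset_forward_integrable_part[OF _ assms(1)]) auto
qed

section \<open>The backward case by time reversal\<close>

lemma backward_integrable_part_eq_forward:
  "backward_integrable_part G \<alpha> \<beta> E = forward_integrable_part G \<beta> \<alpha> E"
proof -
  have "\<exists>\<delta>. solution G \<beta> \<alpha> E {0..} \<delta> \<and> \<delta> 0 = g"
    if "solution G \<alpha> \<beta> E {..0} \<gamma>" "\<gamma> 0 = g" for \<gamma> g
    using solution_reverse[OF that(1), of "{0..}"] that(2)
    by (intro exI[of _ "\<lambda>i. \<gamma> (- i)"]) (auto simp: is_interval_ci)
  moreover have "\<exists>\<gamma>. solution G \<alpha> \<beta> E {..0} \<gamma> \<and> \<gamma> 0 = g"
    if "solution G \<beta> \<alpha> E {0..} \<delta>" "\<delta> 0 = g" for \<delta> g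
    using solution_reverse[OF that(1), of "{..0}"] that(2)
    by (intro exI[of _ "\<lambda>i. \<delta> (- i)"]) (auto simp: is_interval_ic)
  ultimately show ?thesis
    unfolding backward_integrable_part_def forward_integrable_part_def by blast
qed

lemma D_b_eq_C_f: "D_b \<alpha> \<beta> E k = C_f \<beta> \<alpha> E k"
  by (induction k) auto

lemma E_b_eq_E_f: "E_b \<alpha> \<beta> E k = E_f \<beta> \<alpha> E k"
  by (cases k) (auto simp: D_b_eq_C_f)

section \<open>The integrable part as the largest two-sided invariant subset\<close>

text \<open>
  Every translate of a two-sided solution is again one, so all values of such a solution are points of
  integrability, in particular the two neighbours of its value at \<open>0\<close>.
\<close>

lemma integrable_part_invariant:
  "\<beta> ` integrable_part G \<alpha> \<beta> E \<subseteq> \<alpha> ` integrable_part G \<alpha> \<beta> E"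
  "\<alpha> ` integrable_part G \<alpha> \<beta> E \<subseteq> \<beta> ` integrable_part G \<alpha> \<beta> E"
proof -
  have orbit: "\<gamma> c \<in> integrable_part G \<alpha> \<beta> E" if "solution G \<alpha> \<beta> E UNIV \<gamma>" for \<gamma> c
  proof -
    have "solution G \<alpha> \<beta> E UNIV (\<lambda>i. \<gamma> (i + c))"
      by (rule solution_translate[OF that]) auto
    moreover have "\<gamma> c \<in> E"
      using that unfolding solution_def by simp
    ultimately show ?thesis
      unfolding integrable_part_def by force
  qed
  have step: "\<beta> (\<gamma> i) = \<alpha> (\<gamma> (i + 1))" if "solution G \<alpha> \<beta> E UNIV \<gamma>" for \<gamma> i
    using that unfolding solution_def admissible_sequence_def by simp
  have neighbours: "\<beta> g \<in> \<alpha> ` integrable_part G \<alpha> \<beta> E \<and> \<alpha> g \<in> \<beta> ` integrable_part G \<alpha> \<beta> E"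
    if "g \<in> integrable_part G \<alpha> \<beta> E" for g
  proof -
    obtain \<gamma> where sol: "solution G \<alpha> \<beta> E UNIV \<gamma>" and "\<gamma> 0 = g"
      using \<open>g \<in> integrable_part G \<alpha> \<beta> E\<close> unfolding integrable_part_def by blast
    then have "\<beta> g = \<alpha> (\<gamma> 1)" "\<alpha> g = \<beta> (\<gamma> (- 1))"
      using step[OF sol, of 0] step[OF sol, of "- 1"] by simp_all
    then show ?thesis
      using orbit[OF sol] by blast
  qed
  show "\<beta> ` integrable_part G \<alpha> \<beta> E \<subseteq> \<alpha> ` integrable_part G \<alpha> \<beta> E"
    and "\<alpha> ` integrable_part G \<alpha> \<beta> E \<subseteq> \<beta> ` integrable_part G \<alpha> \<beta> E"
    using neighbours by blast+
qed

text \<open>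
  Invariance in each direction yields a half-infinite solution through \<open>g\<close>, and these two glue at
  their common value at \<open>0\<close>.
\<close>

lemma invariant_subset_integrable_part:
  assumes "S \<subseteq> E" and "E \<subseteq> points G" and "\<beta> ` S \<subseteq> \<alpha> ` S" and "\<alpha> ` S \<subseteq> \<beta> ` S"
  shows "S \<subseteq> integrable_part G \<alpha> \<beta> E"
proof
  fix g assume "g \<in> S"
  have "g \<in> forward_integrable_part G \<alpha> \<beta> E"
    using forward_invariant_subset_forward_integrable_part assms(1-3) \<open>g \<in> S\<close> by blast
  then obtain \<gamma> where \<gamma>: "solution G \<alpha> \<beta> E {0..} \<gamma>" "\<gamma> 0 = g"
    unfolding forward_integrable_part_def by blast
  have "g \<in> backward_integrable_part G \<alpha> \<beta> E"
    unfolding backward_integrable_part_eq_forward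
    using forward_invariant_subset_forward_integrable_part assms(1,2,4) \<open>g \<in> S\<close> by blast
  then obtain \<delta> where \<delta>: "solution G \<alpha> \<beta> E {..0} \<delta>" "\<delta> 0 = g"
    unfolding backward_integrable_part_def by blast
  have "solution G \<alpha> \<beta> E UNIV (\<lambda>i. if 0 \<le> i then \<gamma> i else \<delta> i)"
    using solution_glue[OF \<gamma>(1) \<delta>(1)] \<gamma>(2) \<delta>(2) by simp
  then show "g \<in> integrable_part G \<alpha> \<beta> E"
    unfolding integrable_part_def using \<gamma>(2) \<open>g \<in> S\<close> \<open>S \<subseteq> E\<close> by force
qed

lemma invariant_subset_E_fb:
  assumes "S \<subseteq> E" and "\<beta> ` S \<subseteq> \<alpha> ` S" and "\<alpha> ` S \<subseteq> \<beta> ` S"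
  shows "S \<subseteq> E_fb \<alpha> \<beta> E k"
proof (induction k)
  case (Suc k)
  then have "\<beta> ` S \<subseteq> \<alpha> ` E_fb \<alpha> \<beta> E k" "\<alpha> ` S \<subseteq> \<beta> ` E_fb \<alpha> \<beta> E k"
    using assms(2,3) by blast+
  then show ?case
    using assms(1) by auto
qed (simp add: assms(1))

lemma integrable_part_eq_stable_E_fb:
  assumes "E \<subseteq> points G"
    and stable: "C_fb \<alpha> \<beta> E k = C_fb \<alpha> \<beta> E (Suc k)" "D_fb \<alpha> \<beta> E k = D_fb \<alpha> \<beta> E (Suc k)"
  shows "integrable_part G \<alpha> \<beta> E = E_fb \<alpha> \<beta> E (Suc k)"
proof
  show "integrable_part G \<alpha> \<beta> E \<subseteq> E_fb \<alpha> \<beta> E (Suc k)"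
    by (rule invariant_subset_E_fb[OF _ integrable_part_invariant])
      (auto simp: integrable_part_def)
next
  have "\<beta> ` E_fb \<alpha> \<beta> E (Suc k) \<subseteq> C_fb \<alpha> \<beta> E k"
    unfolding E_fb_Suc_eq by blast
  also have "\<dots> = \<alpha> ` E_fb \<alpha> \<beta> E (Suc k)"
    unfolding stable(1) by (rule C_fb_def)
  finally have fwd: "\<beta> ` E_fb \<alpha> \<beta> E (Suc k) \<subseteq> \<alpha> ` E_fb \<alpha> \<beta> E (Suc k)" .
  have "\<alpha> ` E_fb \<alpha> \<beta> E (Suc k) \<subseteq> D_fb \<alpha> \<beta> E k"
    unfolding E_fb_Suc_eq by blast
  also have "\<dots> = \<beta> ` E_fb \<alpha> \<beta> E (Suc k)"
    unfolding stable(2) by (rule D_fb_def)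
  finally have bwd: "\<alpha> ` E_fb \<alpha> \<beta> E (Suc k) \<subseteq> \<beta> ` E_fb \<alpha> \<beta> E (Suc k)" .
  have "E_fb \<alpha> \<beta> E (Suc k) \<subseteq> E"
    unfolding E_fb_Suc_eq by blast
  then show "E_fb \<alpha> \<beta> E (Suc k) \<subseteq> integrable_part G \<alpha> \<beta> E"
    using invariant_subset_integrable_part assms(1) fwd bwd by blast
qed

section \<open>The three algorithms compute the integrable parts\<close>

theorem theorem3p6:
  fixes G :: "'g manifold" and M :: "'m manifold"
    and \<alpha> \<beta> :: "'g \<Rightarrow> 'm" and \<epsilon> :: "'m \<Rightarrow> 'g" and \<iota> :: "'g \<Rightarrow> 'g" and \<mu> :: "'g \<Rightarrow> 'g \<Rightarrow> 'g"
    and E :: "'g set"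
  assumes "lie_groupoid G M \<alpha> \<beta> \<epsilon> \<iota> \<mu>"
    and "submanifold G E"
  shows "(\<forall>k. C_f \<alpha> \<beta> E k = C_f \<alpha> \<beta> E (k + 1) \<longrightarrow>
            E_f \<alpha> \<beta> E (k + 1) = E_f \<alpha> \<beta> E (k + 2) \<and>
            forward_integrable_part G \<alpha> \<beta> E = E_f \<alpha> \<beta> E (k + 1)) \<and>
         (\<forall>k. D_b \<alpha> \<beta> E k = D_b \<alpha> \<beta> E (k + 1) \<longrightarrow>
            E_b \<alpha> \<beta> E (k + 1) = E_b \<alpha> \<beta> E (k + 2) \<and>
            backward_integrable_part G \<alpha> \<beta> E = E_b \<alpha> \<beta> E (k + 1)) \<and>
         (\<forall>k. C_fb \<alpha> \<beta> E k = C_fb \<alpha> \<beta> E (k + 1) \<and> D_fb \<alpha> \<beta> E k = D_fb \<alpha> \<beta> E (k + 1) \<longrightarrow>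
            E_fb \<alpha> \<beta> E (k + 1) = E_fb \<alpha> \<beta> E (k + 2) \<and>
            integrable_part G \<alpha> \<beta> E = E_fb \<alpha> \<beta> E (k + 1))"
proof (intro conjI allI impI)
  have E: "E \<subseteq> points G"
    using assms(2) unfolding submanifold_def immersed_in_def by blast
  fix k
  {
    assume *: "C_f \<alpha> \<beta> E k = C_f \<alpha> \<beta> E (k + 1)"
    then show "E_f \<alpha> \<beta> E (k + 1) = E_f \<alpha> \<beta> E (k + 2)"
      by simp
    show "forward_integrable_part G \<alpha> \<beta> E = E_f \<alpha> \<beta> E (k + 1)"
      using forward_integrable_part_eq_stable_E_f[OF E] * unfolding Suc_eq_plus1 .
  next
    assume *: "D_b \<alpha> \<beta> E k = D_b \<alpha> \<beta> E (k + 1)"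
    then show "E_b \<alpha> \<beta> E (k + 1) = E_b \<alpha> \<beta> E (k + 2)"
      by simp
    show "backward_integrable_part G \<alpha> \<beta> E = E_b \<alpha> \<beta> E (k + 1)"
      using forward_integrable_part_eq_stable_E_f[OF E] *
      unfolding backward_integrable_part_eq_forward D_b_eq_C_f E_b_eq_E_f Suc_eq_plus1 .
  next
    assume *: "C_fb \<alpha> \<beta> E k = C_fb \<alpha> \<beta> E (k + 1) \<and> D_fb \<alpha> \<beta> E k = D_fb \<alpha> \<beta> E (k + 1)"
    then have "E_fb \<alpha> \<beta> E (Suc k) = E_fb \<alpha> \<beta> E (Suc (Suc k))"
      unfolding E_fb_Suc_eq[of _ _ _ k] E_fb_Suc_eq[of _ _ _ "Suc k"] by simp
    then show "E_fb \<alpha> \<beta> E (k + 1) = E_fb \<alpha> \<beta> E (k + 2)"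
      by simp
    show "integrable_part G \<alpha> \<beta> E = E_fb \<alpha> \<beta> E (k + 1)"
      using integrable_part_eq_stable_E_fb[OF E] * unfolding Suc_eq_plus1 by blast
  }
qed

end
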